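(* Let $\lambda$ be a nonzero real number. For all integers $n,k\ge 0$ with $n\ge k$, \[ S_{2,\lambda}(n,k)=\sum_{m=k}^{n}S_{J,\lambda}^{(2)}(m,k)\,S_{1,\lambda}(n,m). \]
   Context: For a nonzero real $\lambda$, set $(x)_{0,\lambda}=1$ and $(x)_{n,\lambda}=x(x-\lambda)\cdots(x-(n-1)\lambda)$ for $n\ge1$. Let $e_\lambda^x(t)=\sum_{n\ge0}(x)_{n,\lambda}\frac{t^n}{n!}=(1+\lambda t)^{x/\lambda}$ and $e_\lambda(t)=e_\lambda^1(t)$. Let $\log_\lambda$ be the compositional inverse of $e_\lambda$, so that $\log_\lambda(1+t)=\frac{1}{\lambda}\big((1+t)^\lambda-1\big)$. The degenerate Stirling numbers of the first kind are defined by $\frac{1}{k!}(\log_\lambda(1+t))^k=\sum_{n\ge k}S_{1,\lambda}(n,k)\frac{t^n}{n!}$, those of the second kind by $\frac{1}{k!}(e_\lambda(t)-1)^k=\sum_{n\ge k}S_{2,\lambda}(n,k)\frac{t^n}{n!}$, and the Jindalrae-Stirling numbers of the second kind by $\frac{1}{k!}\big(e_\lambda(e_\lambda(t)-1)-1\big)^k=\sum_{n\ge k}S_{J,\lambda}^{(2)}(n,k)\frac{t^n}{n!}$ (all for $k\ge0$, as formal power series in $t$). *)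

theory Defs
  imports Complex_Main "HOL-Computational_Algebra.Formal_Power_Series"
begin

unbundle fps_syntax

definition degen_falling :: "real \<Rightarrow> real \<Rightarrow> nat \<Rightarrow> real" where
  "degen_falling lam x n = (\<Prod>i<n. x - real i * lam)"

definition degen_exp_pow :: "real \<Rightarrow> real \<Rightarrow> real fps" where
  "degen_exp_pow lam x = Abs_fps (\<lambda>n. degen_falling lam x n / fact n)"

definition degen_exp :: "real \<Rightarrow> real fps" where
  "degen_exp lam = degen_exp_pow lam 1"

text \<open>
  The formal series \<open>log\<^sub>\<lambda>(1 + t)\<close> in \<open>t\<close>. The series \<open>e\<^sub>\<lambda>\<close> has constant term 1, so the
  compositional inverse is taken of \<open>e\<^sub>\<lambda>(t) - 1\<close>: \<open>s = e\<^sub>\<lambda>(t) - 1\<close> iff \<open>t = log\<^sub>\<lambda>(1 + s)\<close>.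
  Lemma \<open>degen_log1p_eq\<close> below gives the closed form.
\<close>
definition degen_log1p :: "real \<Rightarrow> real fps" where
  "degen_log1p lam = fps_inv (degen_exp lam - 1)"

text \<open>
  Coefficients in the exponential generating functions. Each \<open>k\<close>-th power has order at least \<open>k\<close>,
  so the values for \<open>n < k\<close> are 0 and the expansions start at \<open>n = k\<close>.
\<close>
definition degen_stirling1 :: "real \<Rightarrow> nat \<Rightarrow> nat \<Rightarrow> real" where
  "degen_stirling1 lam n k =
     fact n * (fps_const (1 / fact k) * degen_log1p lam ^ k) $ n"

definition degen_stirling2 :: "real \<Rightarrow> nat \<Rightarrow> nat \<Rightarrow> real" where
  "degen_stirling2 lam n k =
     fact n * (fps_const (1 / fact k) * (degen_exp lam - 1) ^ k) $ n"

definition jindalrae_stirling2 :: "real \<Rightarrow> nat \<Rightarrow> nat \<Rightarrow> real" where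
  "jindalrae_stirling2 lam n k =
     fact n * (fps_const (1 / fact k) *
       ((degen_exp lam oo (degen_exp lam - 1)) - 1) ^ k) $ n"

lemma degen_exp_pow_eq_binomial:
  assumes "lam \<noteq> 0"
  shows "degen_exp_pow lam x =
           fps_compose (fps_binomial (x / lam)) (fps_const lam * fps_X)"
proof (rule fps_ext)
  fix n
  have "lam ^ n * (\<Prod>i<n. x / lam - real i) = (\<Prod>i<n. lam * (x / lam - real i))"
    by (simp add: prod.distrib)
  also have "\<dots> = degen_falling lam x n"
    unfolding degen_falling_def using assms
    by (intro prod.cong) (auto simp: field_simps)
  finally show "degen_exp_pow lam x $ n =
      fps_compose (fps_binomial (x / lam)) (fps_const lam * fps_X) $ n"
    by (simp add: degen_exp_pow_def gbinomial_prod_rev fps_compose_linear atLeast0LessThan)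
qed

lemma degen_exp_nth_0: "(degen_exp lam - 1) $ 0 = 0"
  and degen_exp_nth_1: "(degen_exp lam - 1) $ 1 \<noteq> 0"
  by (simp_all add: degen_exp_def degen_exp_pow_def degen_falling_def)

lemma degen_exp_ODE:
  "(1 + fps_const lam * fps_X) * fps_deriv (degen_exp lam) = degen_exp lam"
proof (rule fps_ext)
  fix n
  have step: "real (Suc m) * degen_exp lam $ Suc m = (1 - real m * lam) * degen_exp lam $ m" for m
    by (simp add: degen_exp_def degen_exp_pow_def degen_falling_def fact_Suc
          del: of_nat_Suc)
  have "((1 + fps_const lam * fps_X) * fps_deriv (degen_exp lam)) $ n =
      real (Suc n) * degen_exp lam $ Suc n + lam * (real n * degen_exp lam $ n)"
    by (cases n) (simp_all add: distrib_right mult.assoc)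
  also have "\<dots> = degen_exp lam $ n"
    unfolding step by (simp add: algebra_simps)
  finally show "((1 + fps_const lam * fps_X) * fps_deriv (degen_exp lam)) $ n = degen_exp lam $ n" .
qed

lemma degen_log1p_eq:
  assumes "lam \<noteq> 0"
  shows "degen_log1p lam = fps_const (1 / lam) * (fps_binomial lam - 1)"
proof -
  let ?E = "degen_exp lam" and ?f = "degen_exp lam - 1" and ?B = "fps_binomial lam"
  let ?L = "fps_const (1 / lam) * (?B - 1)"
  define G where "G = fps_compose ?B ?f"
  define H where "H = 1 + fps_const lam * (fps_X :: real fps)"
  note f0 = degen_exp_nth_0[of lam] and f1 = degen_exp_nth_1[of lam]
  have E0: "?E \<noteq> 0"
    using f0 by auto
  have B: "(1 + fps_X) * fps_deriv ?B = fps_const lam * ?B"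
  proof (rule fps_ext)
    fix n
    have "real (Suc n) * (lam gchoose Suc n) = (lam - real n) * (lam gchoose n)"
      using gbinomial_absorb_comp[of lam n] gbinomial_absorption[of n lam]
      by (simp del: of_nat_Suc)
    then have "real (Suc n) * (lam gchoose Suc n) + real n * (lam gchoose n) = lam * (lam gchoose n)"
      by (simp add: algebra_simps del: of_nat_Suc)
    then show "((1 + fps_X) * fps_deriv ?B) $ n = (fps_const lam * ?B) $ n"
      by (cases n) (simp_all add: distrib_right)
  qed
  have "fps_compose ((1 + fps_X) * fps_deriv ?B) ?f = ?E * fps_compose (fps_deriv ?B) ?f"
    using f0 by (simp add: fps_compose_mult_distrib fps_compose_add_distrib)
  moreover have "fps_compose (fps_const lam * ?B) ?f = fps_const lam * G"
    using f0 by (simp add: fps_compose_mult_distrib G_def)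
  ultimately have 1: "?E * fps_compose (fps_deriv ?B) ?f = fps_const lam * G"
    using B by simp
  have 2: "fps_deriv G = fps_compose (fps_deriv ?B) ?f * fps_deriv ?E"
    unfolding G_def using f0 by (simp add: fps_compose_deriv)
  have "?E * (H * fps_deriv G) =
        (?E * fps_compose (fps_deriv ?B) ?f) * (H * fps_deriv ?E)"
    by (simp add: 2 ac_simps)
  also have "\<dots> = ?E * (fps_const lam * G)"
    unfolding 1 H_def degen_exp_ODE by (rule mult.commute)
  finally have "H * fps_deriv G = fps_const lam * G"
    using E0 by simp
  moreover have "H * fps_deriv H = fps_const lam * H"
    by (simp add: H_def)
  ultimately have ODE: "H * fps_deriv (G - H) = fps_const lam * (G - H)"
    by (simp add: right_diff_distrib)
  have D: "real (Suc n) * (G - H) $ Suc n = (lam - lam * real n) * (G - H) $ n" for n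
    using arg_cong[OF ODE, of "\<lambda>a. a $ n"] unfolding H_def
    by (cases n) (simp_all add: distrib_right mult.assoc algebra_simps)
  have "(G - H) $ n = 0" for n
  proof (induction n)
    case 0
    show ?case by (simp add: G_def H_def)
  next
    case (Suc n)
    then show ?case using D[of n] by (simp del: of_nat_Suc)
  qed
  then have GH: "G = H" by (simp add: fps_eq_iff)
  have "fps_compose ?L ?f = fps_const (1 / lam) * (G - 1)"
    using f0 by (simp add: fps_compose_mult_distrib fps_compose_sub_distrib G_def)
  also have "\<dots> = fps_X"
    using assms by (simp add: GH H_def mult.assoc[symmetric])
  finally have "fps_compose ?L ?f = fps_compose (fps_inv ?f) ?f"
    using fps_inv[OF f0 f1] by simp
  then have "fps_compose (fps_compose ?L ?f) (fps_inv ?f) =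
      fps_compose (fps_compose (fps_inv ?f) ?f) (fps_inv ?f)" by simp
  moreover have i0: "fps_inv ?f $ 0 = 0"
    by (simp add: fps_inv_def)
  ultimately show ?thesis
    unfolding degen_log1p_def
    using fps_compose_assoc[OF i0 f0, of ?L] fps_compose_assoc[OF i0 f0, of "fps_inv ?f"]
      fps_inv_right[OF f0 f1] by simp
qed

end

theory Submission
  imports Defs
begin

text \<open>
  Since \<open>log\<^sub>\<lambda>(1 + t)\<close> is the right compositional inverse of \<open>e\<^sub>\<lambda>(t) - 1\<close>, substituting it into
  \<open>e\<^sub>\<lambda>(e\<^sub>\<lambda>(t) - 1) - 1\<close> gives back \<open>e\<^sub>\<lambda>(t) - 1\<close>. The theorem compares coefficients in the
  \<open>k\<close>-th powers of this identity.
\<close>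

lemma degen_log1p_nth_0: "degen_log1p lam $ 0 = 0"
  by (simp add: degen_log1p_def fps_inv_def)

lemma iterated_degen_exp_compose_degen_log1p:
  "((degen_exp lam oo (degen_exp lam - 1)) - 1) oo degen_log1p lam = degen_exp lam - 1"
proof -
  \<comment> \<open>Composition may be reassociated because both inner series have constant term
    0.\<close>
  have "(degen_exp lam oo (degen_exp lam - 1)) oo degen_log1p lam =
        degen_exp lam oo ((degen_exp lam - 1) oo degen_log1p lam)"
    using fps_compose_assoc[OF degen_log1p_nth_0 degen_exp_nth_0] by simp
  also have "(degen_exp lam - 1) oo degen_log1p lam = fps_X"
    unfolding degen_log1p_def by (rule fps_inv_right[OF degen_exp_nth_0 degen_exp_nth_1])
  finally show ?thesis
    by (simp add: fps_compose_sub_distrib)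
qed

theorem theorem2:
  fixes lam :: real and n k :: nat
  assumes "lam \<noteq> 0" and "k \<le> n"
  shows "degen_stirling2 lam n k =
           (\<Sum>m=k..n. jindalrae_stirling2 lam m k * degen_stirling1 lam n m)"
proof -
  let ?L = "degen_log1p lam"
  define G where "G = (degen_exp lam oo (degen_exp lam - 1)) - 1"
  have "G $ 0 = 0"
    unfolding G_def using degen_exp_nth_0[of lam] by simp
  \<comment> \<open>\<open>G\<close> has order at least 1, so \<open>G ^ k\<close> has order at
    least \<open>k\<close>; hence the sum may start at \<open>m = k\<close>.\<close>
  then have G_below: "(G ^ k) $ m = 0" if "m < k" for m
    using that startsby_zero_power_prefix by blast
  have "(degen_exp lam - 1) ^ k = G ^ k oo ?L"
    using fps_compose_power[OF degen_log1p_nth_0, of G lam k]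
      iterated_degen_exp_compose_degen_log1p[of lam] unfolding G_def by simp
  then have "((degen_exp lam - 1) ^ k) $ n = (\<Sum>m=0..n. (G ^ k) $ m * (?L ^ m) $ n)"
    by (simp add: fps_compose_nth)
  also have "\<dots> = (\<Sum>m=k..n. (G ^ k) $ m * (?L ^ m) $ n)"
    by (rule sum.mono_neutral_right) (auto simp: G_below)
  \<comment> \<open>In each summand the \<open>fact m\<close> of the Jindalrae number cancels the
    \<open>1 / fact m\<close> of the first-kind number, leaving the common factor
    \<open>fact n / fact k\<close> on both sides.\<close>
  finally show ?thesis
    unfolding degen_stirling2_def jindalrae_stirling2_def degen_stirling1_def G_def[symmetric]
    by (simp add: sum_distrib_left sum_divide_distrib mult.left_commute)
qed

end
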